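(* Let $q\in\mathbb C$ with $0<|q|<1$, let $x=\cos\theta\in[-1,1]$ ($\theta\in[0,\pi]$), let $\beta,\gamma\in(-1,1)\setminus\{0\}$, and let $t\in\mathbb C$ with $|t|<1-\beta^2$. Then $$\frac1{(te^{i\theta};q)_\infty}\;{}_2\phi_1\!\left(\beta,\beta e^{2i\theta};\beta^2;q,te^{-i\theta}\right)=\sum_{n=0}^\infty\frac{(\beta;q)_n\,t^n}{(\gamma,\beta^2;q)_n}\,C_n(x;\gamma|q)\;{}_6\phi_5\!\left(\beta\gamma^{-1},\beta q^n,0,0,0,0;\ \gamma q^{n+1},\pm\beta q^{n/2},\pm\beta q^{(n+1)/2};\ q,\gamma t^2\right).$$
   Context: Notation: $(a;q)_0=1$, $(a;q)_n=\prod_{j=0}^{n-1}(1-aq^j)$, $(a;q)_\infty=\prod_{j\ge0}(1-aq^j)$, $(a_1,\dots,a_r;q)_n=\prod_i(a_i;q)_n$ (also for $n=\infty$). In a list of parameters, $\pm a$ stands for the two entries $a,-a$. A square root $q^{1/2}$ is fixed and $q^{m/2}=(q^{1/2})^m$. The basic hypergeometric series, with upper parameters listed before the first semicolon and lower parameters before the second, is $${}_r\phi_s(a_1,\dots,a_r;b_1,\dots,b_s;q,z)=\sum_{k=0}^\infty\frac{(a_1,\dots,a_r;q)_k}{(q,b_1,\dots,b_s;q)_k}\left((-1)^kq^{\binom k2}\right)^{1+s-r}z^k.$$ The continuous $q$-ultraspherical/Rogers polynomials are, for $x=\cos\theta$, $$C_n(x;\beta|q)=\frac{(\beta;q)_n}{(q;q)_n}e^{in\theta}\,{}_2\phi_1\!\left(q^{-n},\beta;\beta^{-1}q^{1-n};q,q\beta^{-1}e^{-2i\theta}\right).$$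 *)

theory Defs
  imports "HOL-Analysis.Analysis"
begin

definition qpoch :: "complex \<Rightarrow> complex \<Rightarrow> nat \<Rightarrow> complex" where
  "qpoch a q n = (\<Prod>j<n. 1 - a * q ^ j)"

definition qpoch_inf :: "complex \<Rightarrow> complex \<Rightarrow> complex" where
  "qpoch_inf a q = (\<Prod>j. 1 - a * q ^ j)"

definition qpochs :: "complex list \<Rightarrow> complex \<Rightarrow> nat \<Rightarrow> complex" where
  "qpochs as q n = (\<Prod>a\<leftarrow>as. qpoch a q n)"

text \<open>
  The basic hypergeometric series with upper parameters \<open>as\<close> and lower parameters \<open>bs\<close>. The
  exponent \<open>1 + s - r\<close> may be negative, so it is an integer power. For a series that terminates
  because of an upper parameter \<open>q\<^sup>-\<^sup>n\<close>, all terms with index above \<open>n\<close> are 0, also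
  where a lower factor vanishes as well, since \<open>0 / 0 = 0\<close>.
\<close>

definition basic_hyp :: "complex list \<Rightarrow> complex list \<Rightarrow> complex \<Rightarrow> complex \<Rightarrow> complex" where
  "basic_hyp as bs q z =
     (\<Sum>k. qpochs as q k / qpochs (q # bs) q k
        * ((- 1) ^ k * q ^ (k choose 2)) powi (1 + int (length bs) - int (length as)) * z ^ k)"

text \<open>
  The continuous \<open>q\<close>-ultraspherical (Rogers) polynomial at \<open>x \<in> [-1, 1]\<close>, where
  \<open>x = cos \<theta>\<close> is solved by the principal value \<open>\<theta> = arccos x \<in> [0, \<pi>]\<close>.
\<close>

definition rogers_C :: "nat \<Rightarrow> real \<Rightarrow> complex \<Rightarrow> complex \<Rightarrow> complex" where
  "rogers_C n x \<beta> q =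
     (let \<theta> = arccos x in
        qpoch \<beta> q n / qpoch q q n * cis (real n * \<theta>)
        * basic_hyp [q powi (- int n), \<beta>] [inverse \<beta> * q powi (1 - int n)] q
            (q * inverse \<beta> * cis (- 2 * \<theta>)))"

end

theory Submission
  imports Defs
begin

text \<open>
  Both sides are the generating function of the Rogers polynomials with parameter \<open>b\<close>, on the
  right rewritten in terms of the Rogers polynomials with parameter \<open>c\<close>. Three facts carry the proof.

  First, the left-hand side is \<open>\<Sum>n. C n (x; b | q) * t ^ n / qpoch (b\<^sup>2) q n\<close>
  (\<open>rogers_generating_function\<close>). Expanding the infinite product by Euler's formula and
  multiplying out the two series, this becomes a finite identity for each power of \<open>t\<close>, which
  is an instance of \<open>sum_gauss_binomial_qpoch_expansion\<close> and follows by induction from the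
  \<open>q\<close>-Pascal rule.

  Second, Rogers's connection formula \<open>rogers_sum_connection\<close> expresses \<open>C n (x; b | q)\<close> through
  the polynomials \<open>C m (x; c | q)\<close> with \<open>m + 2 * k = n\<close>. It holds because both sides satisfy the
  same three-term recurrence.

  Third, after insertion of the connection formula the coefficient of \<open>C m (x; c | q)\<close> is a
  series over \<open>k\<close>, and splitting the shifted factorials at \<open>m\<close> shows that it is a multiple
  of the \<open>6\<phi>5\<close> series with the stated prefactor (\<open>connection_term_factor\<close>).

  The interchange of the summations over \<open>n\<close> and over \<open>m\<close> is justified by absolute convergence
  (\<open>sums_rows_of_sums_step_two_pairs\<close>): shifted factorials and their reciprocals are bounded,
  the polynomials grow at most linearly in their degree, and \<open>t\<close> lies in the open unit disc.

  All polynomials are handled as \<open>rogers_sum\<close>, a polynomial in \<open>w = exp (- 2 \<i> \<theta>)\<close> without the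
  phase \<open>exp (\<i> n \<theta>)\<close>; \<open>rogers_C_eq_rogers_sum\<close> translates.
\<close>

section \<open>Shifted factorials and Gaussian binomial coefficients\<close>

lemma qpoch_0 [simp]: "qpoch a q 0 = 1"
  by (simp add: qpoch_def)

lemma qpoch_Suc: "qpoch a q (Suc n) = qpoch a q n * (1 - a * q ^ n)"
  by (simp add: qpoch_def)

lemma qpoch_Suc_shift: "qpoch a q (Suc n) = (1 - a) * qpoch (a * q) q n"
  unfolding qpoch_def by (subst prod.lessThan_Suc_shift) (simp add: mult_ac)

lemma qpoch_add: "qpoch a q (m + n) = qpoch a q m * qpoch (a * q ^ m) q n"
  by (induction n) (simp_all add: qpoch_Suc power_add mult_ac)

lemma qpoch_neq_0:
  assumes "norm a < 1" "norm q < 1"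
  shows "qpoch a q n \<noteq> 0"
proof -
  have "a * q ^ j \<noteq> 1" for j
  proof
    assume "a * q ^ j = 1"
    hence "norm a * norm q ^ j = 1"
      by (metis norm_mult norm_one norm_power)
    moreover have "norm a * norm q ^ j \<le> norm a * 1"
      using assms by (intro mult_left_mono) (auto simp: power_le_one)
    ultimately show False using assms by simp
  qed
  thus ?thesis by (auto simp: qpoch_def)
qed

text \<open>
  The Gaussian binomial coefficient, by its Pascal rule. Divisions by \<open>qpoch q q k\<close> are thereby
  kept out of the inductions below.
\<close>
fun gauss_binomial :: "'a::comm_ring_1 \<Rightarrow> nat \<Rightarrow> nat \<Rightarrow> 'a" where
  "gauss_binomial q n 0 = 1"
| "gauss_binomial q 0 (Suc k) = 0"
| "gauss_binomial q (Suc n) (Suc k) = gauss_binomial q n k + q ^ Suc k * gauss_binomial q n (Suc k)"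

lemma gauss_binomial_eq_0: "n < k \<Longrightarrow> gauss_binomial q n k = 0"
  by (induction q n k rule: gauss_binomial.induct) auto

lemma gauss_binomial_refl [simp]: "gauss_binomial q n n = 1"
  by (induction n) (auto simp: gauss_binomial_eq_0)

lemma gauss_binomial_qpoch:
  "gauss_binomial q (i + j) i * qpoch q q i * qpoch q q j = qpoch q q (i + j)"
proof (induction "i + j" arbitrary: i j)
  case (Suc n)
  show ?case
  proof (cases i)
    case i: (Suc i')
    show ?thesis
    proof (cases j)
      case j: (Suc j')
      have "n = i' + j" "n = i + j'"
        using Suc.hyps(2) i j by simp_all
      note 1 = Suc.hyps(1)[OF this(1)] and 2 = Suc.hyps(1)[OF this(2)]
      have "gauss_binomial q (i + j) i * qpoch q q i * qpoch q q j =
          gauss_binomial q (i' + j) i' * qpoch q q i' * qpoch q q j * (1 - q ^ i)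
          + q ^ i * (gauss_binomial q (i + j') i * qpoch q q i * qpoch q q j') * (1 - q ^ j)"
        by (simp add: i j qpoch_Suc algebra_simps)
      also have "\<dots> = qpoch q q (i' + j) * ((1 - q ^ i) + q ^ i * (1 - q ^ j))"
        unfolding 1 2 using i j by (simp add: algebra_simps)
      also have "\<dots> = qpoch q q (i + j)"
        by (simp add: i j qpoch_Suc algebra_simps power_add)
      finally show ?thesis .
    qed simp
  qed simp
qed simp

lemma gauss_binomial_eq:
  assumes "norm q < 1" "k \<le> n"
  shows "gauss_binomial q n k / qpoch q q n = 1 / (qpoch q q k * qpoch q q (n - k))"
  using gauss_binomial_qpoch[of q k "n - k"] assms qpoch_neq_0[of q q]
  by (simp add: field_simps)

lemma sum_gauss_binomial_Suc:
  "(\<Sum>k\<le>Suc n. gauss_binomial q (Suc n) k * f k) =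
   (\<Sum>k\<le>n. gauss_binomial q n k * (f (Suc k) + q ^ k * f k))"
proof -
  have "(\<Sum>k\<le>Suc n. gauss_binomial q (Suc n) k * f k) =
      f 0 + (\<Sum>k\<le>n. q ^ Suc k * gauss_binomial q n (Suc k) * f (Suc k))
      + (\<Sum>k\<le>n. gauss_binomial q n k * f (Suc k))"
    by (subst sum.atMost_Suc_shift) (simp add: algebra_simps sum.distrib)
  also have "f 0 + (\<Sum>k\<le>n. q ^ Suc k * gauss_binomial q n (Suc k) * f (Suc k)) =
      (\<Sum>k\<le>Suc n. q ^ k * gauss_binomial q n k * f k)"
    by (subst sum.atMost_Suc_shift) simp
  also have "\<dots> = (\<Sum>k\<le>n. q ^ k * gauss_binomial q n k * f k)"
    by (simp add: gauss_binomial_eq_0)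
  finally show ?thesis by (simp add: algebra_simps sum.distrib)
qed

text \<open>
  Both sides change in the same way when the length of the sum grows by one: if \<open>X n a b w\<close> is
  either side, then the Pascal rule gives
  \<open>X (n + 1) a b w = (1 - a) * w * X n (a * q) b w + (1 - b) * X n a (b * q) (q * w)\<close>. On the
  right-hand side this rests on \<open>w = (w - b * q ^ k) + b * q ^ k\<close> and on the way in which the
  products \<open>\<Prod>j<k. w - b * q ^ j\<close> scale when \<open>b\<close> and \<open>w\<close> are multiplied by \<open>q\<close>. The two
  parameters have to be independent, since the recursion shifts only one of them at a time.
\<close>
lemma sum_gauss_binomial_qpoch_expansion:
  "(\<Sum>k\<le>n. gauss_binomial q n k * (qpoch a q k * qpoch b q (n - k) * w ^ k)) =
   (\<Sum>k\<le>n. gauss_binomial q n k *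
      (qpoch a q k * qpoch (a * b * q ^ k) q (n - k) * (\<Prod>j<k. w - b * q ^ j)))"
proof (induction n arbitrary: a b w)
  case (Suc n)
  define P where "P w b k = (\<Prod>j<k. w - b * q ^ j)" for w b k
  have P_Suc: "P w b (Suc k) = P w b k * (w - b * q ^ k)" for w b k
    by (simp add: P_def)
  have P_scale: "P (q * w) (b * q) k = q ^ k * P w b k" for k
    by (induction k) (simp_all add: P_def algebra_simps)
  note IH = Suc.IH[folded P_def]
  have "(\<Sum>k\<le>Suc n. gauss_binomial q (Suc n) k * (qpoch a q k * qpoch b q (Suc n - k) * w ^ k)) =
      (1 - a) * w * (\<Sum>k\<le>n. gauss_binomial q n k * (qpoch (a * q) q k * qpoch b q (n - k) * w ^ k))
      + (1 - b) * (\<Sum>k\<le>n. gauss_binomial q n k *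
          (qpoch a q k * qpoch (b * q) q (n - k) * (q * w) ^ k))"
    unfolding sum_gauss_binomial_Suc sum_distrib_left sum.distrib[symmetric]
    by (intro sum.cong refl)
      (simp add: Suc_diff_le qpoch_Suc_shift algebra_simps power_mult_distrib)
  also have "\<dots> = (1 - a) * w * (\<Sum>k\<le>n. gauss_binomial q n k *
        (qpoch (a * q) q k * qpoch (a * q * b * q ^ k) q (n - k) * P w b k))
      + (1 - b) * (\<Sum>k\<le>n. gauss_binomial q n k *
          (qpoch a q k * qpoch (a * (b * q) * q ^ k) q (n - k) * (q ^ k * P w b k)))"
    unfolding IH P_scale ..
  also have "\<dots> = (\<Sum>k\<le>n. gauss_binomial q n k * qpoch (a * b * q ^ Suc k) q (n - k) * P w b k *
        (w * qpoch a q (Suc k) + (1 - b) * q ^ k * qpoch a q k))"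
    unfolding sum_distrib_left sum.distrib[symmetric]
    by (intro sum.cong refl) (simp add: qpoch_Suc_shift algebra_simps)
  also have "\<dots> = (\<Sum>k\<le>n. gauss_binomial q n k * qpoch (a * b * q ^ Suc k) q (n - k) * P w b k *
        (qpoch a q (Suc k) * (w - b * q ^ k) + q ^ k * qpoch a q k * (1 - a * b * q ^ k)))"
    by (intro sum.cong refl) (simp add: qpoch_Suc algebra_simps)
  also have "\<dots> = (\<Sum>k\<le>Suc n. gauss_binomial q (Suc n) k *
      (qpoch a q k * qpoch (a * b * q ^ k) q (Suc n - k) * P w b k))"
    unfolding sum_gauss_binomial_Suc
  proof (intro sum.cong refl)
    fix k assume "k \<in> {..n}"
    hence k: "Suc n - k = Suc (n - k)" by (simp add: Suc_diff_le)
    have "qpoch (a * b * q ^ k) q (Suc (n - k)) =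
        (1 - a * b * q ^ k) * qpoch (a * b * q ^ Suc k) q (n - k)"
      by (simp add: qpoch_Suc_shift mult_ac)
    thus "gauss_binomial q n k * qpoch (a * b * q ^ Suc k) q (n - k) * P w b k *
          (qpoch a q (Suc k) * (w - b * q ^ k) + q ^ k * qpoch a q k * (1 - a * b * q ^ k)) =
        gauss_binomial q n k *
          (qpoch a q (Suc k) * qpoch (a * b * q ^ Suc k) q (Suc n - Suc k) * P w b (Suc k) +
           q ^ k * (qpoch a q k * qpoch (a * b * q ^ k) q (Suc n - k) * P w b k))"
      unfolding k P_Suc by (simp only: diff_Suc_Suc) (simp add: algebra_simps del: power_Suc)
  qed
  finally show ?case by (simp add: P_def)
qed simp

section \<open>The Rogers polynomials without phase factor\<close>

text \<open>
  The Rogers polynomial without its phase: with \<open>w = exp (- 2 \<i> \<theta>)\<close>, multiplying by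
  \<open>exp (\<i> n \<theta>)\<close> gives \<open>C n (cos \<theta>; b | q)\<close>. In contrast to the \<open>2\<phi>1\<close> form its
  coefficients are visibly symmetric under \<open>k \<mapsto> n - k\<close>, and no division by \<open>b\<close> occurs.
\<close>
definition rogers_sum :: "complex \<Rightarrow> complex \<Rightarrow> complex \<Rightarrow> nat \<Rightarrow> complex" where
  "rogers_sum b q w n =
     (\<Sum>k\<le>n. qpoch b q k / qpoch q q k * (qpoch b q (n - k) / qpoch q q (n - k)) * w ^ k)"

text \<open>
  The products \<open>\<Prod>j<k. w - b * q ^ j\<close> are, up to powers of \<open>w\<close>, the shifted factorials of
  \<open>b / w\<close> in the numerator of the \<open>2\<phi>1\<close> on the left-hand side of the theorem. So this is the
  comparison of coefficients behind the generating function.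
\<close>
lemma rogers_sum_expansion:
  assumes "norm q < 1" "norm b < 1"
  shows "rogers_sum b q w n / qpoch (b ^ 2) q n =
    (\<Sum>k\<le>n. qpoch b q k * (\<Prod>j<k. w - b * q ^ j) /
       (qpoch q q k * qpoch (b ^ 2) q k * qpoch q q (n - k)))"
proof -
  have b2: "norm (b ^ 2) < 1"
    using assms by (simp add: norm_power power_less_one_iff)
  have sum: "rogers_sum b q w n =
      (\<Sum>k\<le>n. gauss_binomial q n k * (qpoch b q k * qpoch b q (n - k) * w ^ k)) / qpoch q q n"
    unfolding rogers_sum_def sum_divide_distrib
  proof (intro sum.cong refl)
    fix k assume "k \<in> {..n}"
    hence "k \<le> n" by simp
    have "qpoch b q k / qpoch q q k * (qpoch b q (n - k) / qpoch q q (n - k)) * w ^ k =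
       (1 / (qpoch q q k * qpoch q q (n - k))) * (qpoch b q k * qpoch b q (n - k) * w ^ k)"
      by simp
    also have "\<dots> = gauss_binomial q n k * (qpoch b q k * qpoch b q (n - k) * w ^ k) / qpoch q q n"
      unfolding gauss_binomial_eq[OF assms(1) \<open>k \<le> n\<close>, symmetric] by simp
    finally show "qpoch b q k / qpoch q q k * (qpoch b q (n - k) / qpoch q q (n - k)) * w ^ k =
       gauss_binomial q n k * (qpoch b q k * qpoch b q (n - k) * w ^ k) / qpoch q q n" .
  qed
  have "rogers_sum b q w n / qpoch (b ^ 2) q n = (\<Sum>k\<le>n. gauss_binomial q n k / qpoch q q n *
      (qpoch b q k * (qpoch (b ^ 2 * q ^ k) q (n - k) / qpoch (b ^ 2) q n) *
        (\<Prod>j<k. w - b * q ^ j)))"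
    unfolding sum sum_gauss_binomial_qpoch_expansion sum_divide_distrib power2_eq_square
    by (intro sum.cong refl) simp
  also have "\<dots> = (\<Sum>k\<le>n. qpoch b q k * (\<Prod>j<k. w - b * q ^ j) /
       (qpoch q q k * qpoch (b ^ 2) q k * qpoch q q (n - k)))"
  proof (intro sum.cong refl)
    fix k assume "k \<in> {..n}"
    hence k: "k \<le> n" by simp
    have "B / N = 1 / A" if "N = A * B" "N \<noteq> 0" for A B N :: complex
      using that by simp
    from this[OF _ qpoch_neq_0[OF b2 assms(1)]]
    have eq: "qpoch (b ^ 2 * q ^ k) q (n - k) / qpoch (b ^ 2) q n = 1 / qpoch (b ^ 2) q k"
      using qpoch_add[of "b ^ 2" q k "n - k"] k by simp
    show "gauss_binomial q n k / qpoch q q n *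
      (qpoch b q k * (qpoch (b ^ 2 * q ^ k) q (n - k) / qpoch (b ^ 2) q n) *
        (\<Prod>j<k. w - b * q ^ j)) = qpoch b q k * (\<Prod>j<k. w - b * q ^ j) /
       (qpoch q q k * qpoch (b ^ 2) q k * qpoch q q (n - k))"
      unfolding gauss_binomial_eq[OF assms(1) k] eq by (simp add: mult_ac)
  qed
  finally show ?thesis .
qed

lemma power_neq_1:
  fixes q :: complex
  assumes "norm q < 1"
  shows "1 - q ^ Suc n \<noteq> 0"
proof -
  have "norm (q ^ Suc n) < 1"
    using power_less_one_iff[of "norm q" "Suc n"] assms by (simp only: norm_power) auto
  thus ?thesis by auto
qed

lemma rogers_sum_0 [simp]: "rogers_sum b q w 0 = 1"
  by (simp add: rogers_sum_def)

lemma rogers_sum_1: "rogers_sum b q w (Suc 0) = (1 - b) / (1 - q) * (1 + w)"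
  by (simp add: rogers_sum_def qpoch_Suc distrib_left)

text \<open>
  The coefficients \<open>h k = qpoch b q k / qpoch q q k\<close> satisfy a first-order recursion, so the
  three-term recurrence becomes a polynomial identity for each coefficient of \<open>w\<close>; only the
  two extreme coefficients have to be split off.
\<close>
lemma rogers_sum_recurrence:
  assumes q: "norm q < 1"
  shows "(1 - q ^ Suc (Suc n)) * rogers_sum b q w (Suc (Suc n)) =
    (1 - b * q ^ Suc n) * (1 + w) * rogers_sum b q w (Suc n)
    - (1 - b ^ 2 * q ^ n) * w * rogers_sum b q w n"
proof -
  define h where "h k = qpoch b q k / qpoch q q k" for k
  have h_Suc: "(1 - q ^ Suc k) * h (Suc k) = (1 - b * q ^ k) * h k" for k
    using power_neq_1[OF q] by (simp add: h_def qpoch_Suc)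
  have h0: "h 0 = 1" by (simp add: h_def)
  have H: "rogers_sum b q w n = (\<Sum>k\<le>n. h k * h (n - k) * w ^ k)" for n
    by (simp add: rogers_sum_def h_def)
  have key: "(1 - q ^ Suc (Suc (i + j))) * (h (Suc i) * h (Suc j)) =
      (1 - b * q ^ Suc (i + j)) * (h (Suc i) * h j + h i * h (Suc j))
      - (1 - b ^ 2 * q ^ (i + j)) * (h i * h j)" for i j
  proof -
    define x y A B where "x = h i" "y = h j" "A = q ^ i" "B = q ^ j"
    have i: "h (Suc i) = (1 - b * A) * x / (1 - q * A)" and j: "h (Suc j) = (1 - b * B) * y / (1 - q * B)"
      using h_Suc[of i] h_Suc[of j] power_neq_1[OF q, of i] power_neq_1[OF q, of j]
      by (simp_all add: x_y_A_B_def field_simps)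
    have nz: "1 - q * A \<noteq> 0" "1 - q * B \<noteq> 0"
      using power_neq_1[OF q, of i] power_neq_1[OF q, of j] by (simp_all add: x_y_A_B_def)
    have "(1 - q * (q * (A * B))) * ((1 - b * A) * x / (1 - q * A) * ((1 - b * B) * y / (1 - q * B))) =
      (1 - b * (q * (A * B))) * ((1 - b * A) * x / (1 - q * A) * y + x * ((1 - b * B) * y / (1 - q * B)))
      - (1 - b ^ 2 * (A * B)) * (x * y)"
      using nz by (simp add: divide_simps) algebra
    thus ?thesis unfolding i j by (simp add: power_add x_y_A_B_def)
  qed
  have S2: "rogers_sum b q w (Suc (Suc n)) =
      h (Suc (Suc n)) + h (Suc (Suc n)) * w ^ Suc (Suc n)
      + w * (\<Sum>k\<le>n. h (Suc k) * h (Suc (n - k)) * w ^ k)"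
    unfolding H sum.atMost_Suc[of _ "Suc n"] sum.atMost_Suc_shift[of _ n] sum_distrib_left
    by (simp add: h0 Suc_diff_le algebra_simps cong: sum.cong_simp)
  have S1: "rogers_sum b q w (Suc n) = h (Suc n) + w * (\<Sum>k\<le>n. h (Suc k) * h (n - k) * w ^ k)"
    unfolding H sum.atMost_Suc_shift[of _ n] sum_distrib_left
    by (simp add: h0 algebra_simps)
  have S1': "rogers_sum b q w (Suc n) = h (Suc n) * w ^ Suc n + (\<Sum>k\<le>n. h k * h (Suc (n - k)) * w ^ k)"
    unfolding H by (simp add: h0 Suc_diff_le algebra_simps cong: sum.cong_simp)
  have mid: "(1 - q ^ Suc (Suc n)) * (\<Sum>k\<le>n. h (Suc k) * h (Suc (n - k)) * w ^ k) =
     (1 - b * q ^ Suc n) * ((\<Sum>k\<le>n. h (Suc k) * h (n - k) * w ^ k)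
        + (\<Sum>k\<le>n. h k * h (Suc (n - k)) * w ^ k))
      - (1 - b ^ 2 * q ^ n) * (\<Sum>k\<le>n. h k * h (n - k) * w ^ k)"
    unfolding sum_distrib_left sum.distrib[symmetric] sum_subtractf[symmetric]
  proof (intro sum.cong refl)
    fix k assume "k \<in> {..n}"
    hence k: "k + (n - k) = n" by simp
    show "(1 - q ^ Suc (Suc n)) * (h (Suc k) * h (Suc (n - k)) * w ^ k) =
       (1 - b * q ^ Suc n) * (h (Suc k) * h (n - k) * w ^ k + h k * h (Suc (n - k)) * w ^ k)
       - (1 - b ^ 2 * q ^ n) * (h k * h (n - k) * w ^ k)"
      using arg_cong[OF key[of k "n - k", unfolded k], of "\<lambda>x. x * w ^ k"]
      by (simp only: algebra_simps)
  qed
  let ?M = "\<Sum>k\<le>n. h (Suc k) * h (Suc (n - k)) * w ^ k"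
  let ?L = "\<Sum>k\<le>n. h (Suc k) * h (n - k) * w ^ k"
  let ?R = "\<Sum>k\<le>n. h k * h (Suc (n - k)) * w ^ k"
  have "(1 - q ^ Suc (Suc n)) * rogers_sum b q w (Suc (Suc n)) =
      (1 - q ^ Suc (Suc n)) * h (Suc (Suc n)) * (1 + w ^ Suc (Suc n))
      + w * ((1 - q ^ Suc (Suc n)) * ?M)"
    unfolding S2 by (simp add: algebra_simps del: power_Suc)
  also have "\<dots> = (1 - b * q ^ Suc n) * ((h (Suc n) + w * ?L) + w * (h (Suc n) * w ^ Suc n + ?R))
      - (1 - b ^ 2 * q ^ n) * w * rogers_sum b q w n"
    unfolding h_Suc mid H[of n] by (simp add: algebra_simps)
  also have "(h (Suc n) + w * ?L) + w * (h (Suc n) * w ^ Suc n + ?R) = (1 + w) * rogers_sum b q w (Suc n)"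
    unfolding S1[symmetric] S1'[symmetric] by (simp add: algebra_simps)
  finally show ?thesis by (simp only: mult.assoc)
qed

section \<open>Connection coefficients\<close>

text \<open>
  Up to the factor \<open>1 - c * q ^ m\<close>, Rogers's coefficient of the polynomial of degree \<open>m\<close> with
  parameter \<open>c\<close> in the one of degree \<open>m + 2 * k\<close> with parameter \<open>b\<close>. That factor is left out because
  it is cancelled when the three-term recurrence for the parameter \<open>c\<close> is applied. Indexing by
  \<open>m\<close> and \<open>k\<close> instead of the total degree avoids truncated subtraction.
\<close>
definition connection_coeff :: "complex \<Rightarrow> complex \<Rightarrow> complex \<Rightarrow> nat \<Rightarrow> nat \<Rightarrow> complex" where
  "connection_coeff b c q m k =
     c ^ k * qpoch (b / c) q k * qpoch b q (m + k) / (qpoch q q k * qpoch c q (Suc (m + k)))"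

definition step_two_pairs :: "nat \<Rightarrow> (nat \<times> nat) set" where
  "step_two_pairs n = {(m, k). m + 2 * k = n}"

lemma finite_step_two_pairs [simp]: "finite (step_two_pairs n)"
  by (rule finite_subset[of _ "{..n} \<times> {..n}"]) (auto simp: step_two_pairs_def)

lemma step_two_pairs_0: "step_two_pairs 0 = {(0, 0)}"
  by (auto simp: step_two_pairs_def)

lemma step_two_pairs_1: "step_two_pairs (Suc 0) = {(Suc 0, 0)}"
  by (auto simp: step_two_pairs_def; presburger)

text \<open>
  The recursion that the coefficients must satisfy if the connection formula is to be
  compatible with the three-term recurrences for \<open>b\<close> and for \<open>c\<close>. For \<open>k > 0\<close> all four coefficients
  are polynomial multiples of one common quantity \<open>c0\<close>, and what remains is a polynomial identity
  in \<open>A = q ^ k\<close>, \<open>B = b * q ^ (k - 1)\<close>, \<open>M = q ^ m\<close> and \<open>c\<close>.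
\<close>
lemma connection_coeff_recurrence:
  assumes q: "norm q < 1" and c: "norm c < 1" "c \<noteq> 0" and mk: "m + 2 * k = Suc (Suc n)"
  shows "(1 - q ^ Suc (Suc n)) * ((1 - c * q ^ m) * connection_coeff b c q m k) =
    (1 - b * q ^ Suc n) *
      ((if m = 0 then 0 else (1 - q ^ m) * connection_coeff b c q (m - 1) k)
       + (if k = 0 then 0 else (1 - c ^ 2 * q ^ m) * connection_coeff b c q (Suc m) (k - 1)))
    - (1 - b ^ 2 * q ^ n) *
      (if k = 0 then 0 else (1 - c * q ^ m) * connection_coeff b c q m (k - 1))"
proof (cases k)
  case 0
  hence m: "m = Suc (Suc n)" using mk by simp
  have nz: "qpoch c q j \<noteq> 0" for j
    using qpoch_neq_0[OF c(1) q] .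
  from nz[of "Suc (Suc (Suc n))"] have nz': "1 - c * q ^ m \<noteq> 0"
    by (simp add: qpoch_Suc m)
  have "connection_coeff b c q m 0 * (1 - c * q ^ m) =
      (1 - b * q ^ Suc n) * connection_coeff b c q (Suc n) 0"
    using nz nz' unfolding connection_coeff_def by (simp add: qpoch_Suc m del: power_Suc)
  thus ?thesis by (simp add: 0 m mult.commute del: power_Suc)
next
  case (Suc k')
  have nz: "qpoch c q j \<noteq> 0" "qpoch q q j \<noteq> 0" for j
    using qpoch_neq_0[OF c(1) q] qpoch_neq_0[OF q q] by auto
  define P Q R T A B M where "P = c ^ k' * qpoch (b / c) q k'" "Q = qpoch b q (m + k')"
    "R = qpoch q q k'" "T = qpoch c q (m + k')" "A = q ^ Suc k'" "B = b * q ^ k'" "M = q ^ m"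
  note defs = this
  define c0 where "c0 = P * Q / (R * (1 - A) * T * (1 - c * q ^ (m + k')) * (1 - c * A * M))"
  have f1: "1 - A \<noteq> 0" using power_neq_1[OF q, of k'] by (simp add: defs)
  have f2: "1 - c * q ^ (m + k') \<noteq> 0" using nz(1)[of "Suc (m + k')"] by (simp add: qpoch_Suc)
  have "c * A * M = c * q ^ Suc (m + k')" by (simp add: defs power_add)
  with nz(1)[of "Suc (Suc (m + k'))"] have f3: "1 - c * A * M \<noteq> 0"
    by (simp only: qpoch_Suc) simp
  have Bc: "c * (1 - b / c * q ^ k') = c - B" using c by (simp add: defs field_simps)
  have b': "qpoch b q (Suc (m + k')) = Q * (1 - B * M)"
    by (simp add: defs qpoch_Suc power_add mult_ac)
  have P': "c ^ Suc k' * qpoch (b / c) q (Suc k') = P * (c - B)"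
    unfolding Bc[symmetric] by (simp add: defs qpoch_Suc mult_ac)
  have R': "qpoch q q (Suc k') = R * (1 - A)"
    by (simp add: defs qpoch_Suc)
  have T': "qpoch c q (Suc (m + k')) = T * (1 - c * q ^ (m + k'))"
    by (simp add: defs qpoch_Suc)
  have T'': "qpoch c q (Suc (Suc (m + k'))) = T * (1 - c * q ^ (m + k')) * (1 - c * A * M)"
    by (simp add: defs qpoch_Suc power_add mult_ac)
  have e1: "connection_coeff b c q m (Suc k') = c0 * ((c - B) * (1 - B * M))"
    unfolding connection_coeff_def add_Suc_right P' b' R' T'' by (simp add: c0_def mult_ac)
  have e2: "connection_coeff b c q (Suc m) k' = c0 * ((1 - A) * (1 - B * M))"
    unfolding connection_coeff_def add_Suc b' T'' P_Q_R_T_A_B_M_def(1,3)[symmetric]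
    using f1 by (simp add: c0_def mult_ac)
  have e3: "connection_coeff b c q m k' = c0 * ((1 - A) * (1 - c * A * M))"
    unfolding connection_coeff_def T' P_Q_R_T_A_B_M_def(1,2,3)[symmetric]
    using f1 f3 by (simp add: c0_def mult_ac)
  \<comment> \<open>The factor \<open>1 - M\<close> vanishes for \<open>m = 0\<close>, so the boundary case needs no separate identity.\<close>
  have e4: "(if m = 0 then 0 else (1 - q ^ m) * connection_coeff b c q (m - 1) (Suc k')) =
      c0 * ((1 - M) * (c - B) * (1 - c * A * M))"
  proof (cases m)
    case 0
    thus ?thesis by (simp add: defs)
  next
    case m: (Suc m')
    have "connection_coeff b c q m' (Suc k') = P * (c - B) * Q / (R * (1 - A) * (T * (1 - c * q ^ (m + k'))))"
      unfolding connection_coeff_def P' R' T'[symmetric] by (simp add: defs m mult_ac)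
    also have "\<dots> = c0 * ((c - B) * (1 - c * A * M))"
      using f3 by (simp add: c0_def mult_ac)
    finally show ?thesis by (simp add: m defs)
  qed
  have n: "n = m + 2 * k'" using mk Suc by simp
  have q1: "q ^ Suc (Suc n) = M * A ^ 2"
    by (simp add: n defs power_add power_mult power2_eq_square power_mult_distrib)
  have q2: "b * q ^ Suc n = B * M * A"
    by (simp add: n defs power_add power_mult power2_eq_square power_mult_distrib)
  have q3: "b ^ 2 * q ^ n = B ^ 2 * M"
    by (simp add: n defs power_add power_mult power2_eq_square power_mult_distrib)
  show ?thesis
    unfolding Suc diff_Suc_1 e4
    unfolding e1 e2 e3 q1 q2 q3
    unfolding P_Q_R_T_A_B_M_def(7)[symmetric]
    by (simp only: nat.distinct if_False) algebra
qed

text \<open>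
  Rogers's connection formula. Both sides agree in degrees 0 and 1, and the right-hand side
  satisfies the three-term recurrence for the parameter \<open>b\<close>: multiplication by \<open>1 + w\<close> moves
  each polynomial with parameter \<open>c\<close> to its two neighbouring degrees, and collecting terms leads to
  the recursion of the coefficients.
\<close>
lemma rogers_sum_connection:
  assumes q: "norm q < 1" and c: "norm c < 1" "c \<noteq> 0"
  shows "rogers_sum b q w n = (\<Sum>(m, k)\<in>step_two_pairs n.
    (1 - c * q ^ m) * connection_coeff b c q m k * w ^ k * rogers_sum c q w m)"
proof (induction n rule: less_induct)
  case (less n)
  have nz: "qpoch c q j \<noteq> 0" for j
    using qpoch_neq_0[OF c(1) q] .
  define H where "H = rogers_sum c q w"
  define e where "e = connection_coeff b c q"
  define R where "R n = (\<Sum>(m, k)\<in>step_two_pairs n. (1 - c * q ^ m) * e m k * w ^ k * H m)" for n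
  consider "n = 0" | "n = Suc 0" | n' where "n = Suc (Suc n')"
    by (metis not0_implies_Suc)
  thus ?case
  proof cases
    case 1
    thus ?thesis using nz[of 1]
      by (simp add: step_two_pairs_0 connection_coeff_def qpoch_Suc)
  next
    case 2
    have "1 - c \<noteq> 0" "1 - c * q \<noteq> 0"
      using nz[of "Suc (Suc 0)"] by (auto simp: qpoch_Suc)
    thus ?thesis using 2
      by (simp add: step_two_pairs_1 connection_coeff_def qpoch_Suc rogers_sum_1)
  next
    case (3 n)
    have H_rec: "(1 - c * q ^ m) * (1 + w) * H m = (1 - q ^ Suc m) * H (Suc m)
        + (if m = 0 then 0 else (1 - c ^ 2 * q ^ (m - 1)) * w * H (m - 1))" for m
    proof (cases m)
      case 0
      thus ?thesis using power_neq_1[OF q, of 0] by (simp add: H_def rogers_sum_1)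
    next
      case (Suc m')
      thus ?thesis using rogers_sum_recurrence[OF q, of m' c w] by (simp add: H_def)
    qed
    let ?A = "\<lambda>m k. if m = 0 then 0 else (1 - q ^ m) * e (m - 1) k"
    let ?B = "\<lambda>m k. if k = 0 then 0 else (1 - c ^ 2 * q ^ m) * e (Suc m) (k - 1)"
    let ?D = "\<lambda>m k. if k = 0 then 0 else (1 - c * q ^ m) * e m (k - 1)"
    \<comment> \<open>The functions \<open>?A\<close>, \<open>?B\<close>, \<open>?D\<close> collect what arrives at the index \<open>(m, k)\<close> from
        degree \<open>m - 1\<close>, from degree \<open>m + 1\<close> and from the term of total degree \<open>n\<close>.\<close>
    have A: "(\<Sum>(m, k)\<in>step_two_pairs (Suc (Suc n)). ?A m k * w ^ k * H m) =
        (\<Sum>(m, k)\<in>step_two_pairs (Suc n). e m k * w ^ k * ((1 - q ^ Suc m) * H (Suc m)))"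
      by (rule sum.reindex_bij_witness_not_neutral[symmetric,
            where T' = "{x\<in>step_two_pairs (Suc (Suc n)). fst x = 0}" and S' = "{}" and
              j = "\<lambda>(m, k). (Suc m, k)" and i = "\<lambda>(m, k). (m - 1, k)"])
        (simp, simp, auto simp: step_two_pairs_def gr0_conv_Suc)
    \<comment> \<open>The pair \<open>(0, 0)\<close> is a dummy value for \<open>m = 0\<close>: both summands are 0 there.\<close>
    have B: "(\<Sum>(m, k)\<in>step_two_pairs (Suc (Suc n)). ?B m k * w ^ k * H m) =
        (\<Sum>(m, k)\<in>step_two_pairs (Suc n). e m k * w ^ k *
          (if m = 0 then 0 else (1 - c ^ 2 * q ^ (m - 1)) * w * H (m - 1)))"
      by (rule sum.reindex_bij_witness_not_neutral[symmetric,
            where T' = "{x\<in>step_two_pairs (Suc (Suc n)). snd x = 0}" and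
              S' = "{x\<in>step_two_pairs (Suc n). fst x = 0}" and
              j = "\<lambda>(m, k). if m = 0 then (0, 0) else (m - 1, Suc k)" and
              i = "\<lambda>(m, k). (Suc m, k - 1)"])
        (simp, simp, auto simp: step_two_pairs_def gr0_conv_Suc)
    have D: "(\<Sum>(m, k)\<in>step_two_pairs (Suc (Suc n)). ?D m k * w ^ k * H m) = w * R n"
      unfolding R_def sum_distrib_left
      by (rule sum.reindex_bij_witness_not_neutral[symmetric,
            where T' = "{x\<in>step_two_pairs (Suc (Suc n)). snd x = 0}" and S' = "{}" and
              j = "\<lambda>(m, k). (m, Suc k)" and i = "\<lambda>(m, k). (m, k - 1)"])
        (simp, simp, auto simp: step_two_pairs_def gr0_conv_Suc)
    have "(1 - q ^ Suc (Suc n)) * R (Suc (Suc n)) =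
        (\<Sum>(m, k)\<in>step_two_pairs (Suc (Suc n)).
           ((1 - b * q ^ Suc n) * (?A m k + ?B m k) - (1 - b ^ 2 * q ^ n) * ?D m k) * w ^ k * H m)"
      unfolding R_def sum_distrib_left
    proof (intro sum.cong refl, clarify)
      fix m k assume "(m, k) \<in> step_two_pairs (Suc (Suc n))"
      hence mk: "m + 2 * k = Suc (Suc n)" by (simp add: step_two_pairs_def)
      show "(1 - q ^ Suc (Suc n)) * ((1 - c * q ^ m) * e m k * w ^ k * H m) =
          ((1 - b * q ^ Suc n) * (?A m k + ?B m k) - (1 - b ^ 2 * q ^ n) * ?D m k) * w ^ k * H m"
        unfolding e_def connection_coeff_recurrence[OF q c mk, symmetric] by (simp only: mult.assoc)
    qed
    also have "\<dots> = (1 - b * q ^ Suc n) *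
          ((\<Sum>(m, k)\<in>step_two_pairs (Suc (Suc n)). ?A m k * w ^ k * H m)
           + (\<Sum>(m, k)\<in>step_two_pairs (Suc (Suc n)). ?B m k * w ^ k * H m))
        - (1 - b ^ 2 * q ^ n) * (\<Sum>(m, k)\<in>step_two_pairs (Suc (Suc n)). ?D m k * w ^ k * H m)"
      unfolding sum_distrib_left sum.distrib[symmetric] sum_subtractf[symmetric]
      by (intro sum.cong refl, clarify) (simp only: algebra_simps)
    also have "\<dots> = (1 - b * q ^ Suc n) * ((1 + w) * R (Suc n)) - (1 - b ^ 2 * q ^ n) * (w * R n)"
      unfolding A B D R_def[of "Suc n"] sum_distrib_left sum.distrib[symmetric]
      unfolding case_prod_unfold distrib_left[symmetric] H_rec[symmetric]
      by (simp add: sum_distrib_left mult_ac)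
    also have "R (Suc n) = rogers_sum b q w (Suc n)"
      using less[of "Suc n"] 3 by (simp add: R_def e_def H_def)
    also have "R n = rogers_sum b q w n"
      using less[of n] 3 by (simp add: R_def e_def H_def)
    finally have "(1 - q ^ Suc (Suc n)) * R (Suc (Suc n)) =
        (1 - q ^ Suc (Suc n)) * rogers_sum b q w (Suc (Suc n))"
      unfolding rogers_sum_recurrence[OF q] by (simp only: mult.assoc)
    hence "R (Suc (Suc n)) = rogers_sum b q w (Suc (Suc n))"
      using power_neq_1[OF q, of "Suc n"] by (simp only: mult_cancel_left) auto
    thus ?thesis by (simp add: R_def 3 e_def H_def)
  qed
qed

section \<open>The terminating series for the Rogers polynomials\<close>

text \<open>
  Reversal of the order of factors: the factors of \<open>q powi (- n)\<close> and of \<open>c\<^sup>-\<^sup>1 * q powi (1 - n)\<close>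
  are, up to powers of \<open>q\<close> and \<open>c\<close>, the last factors of \<open>qpoch q q n\<close> and \<open>qpoch c q n\<close>. The
  restriction to \<open>k \<le> n\<close> keeps the lower factors away from 0.
\<close>
lemma qpoch_reverse:
  assumes q: "norm q < 1" "q \<noteq> 0" and c: "norm c < 1" "c \<noteq> 0" and "k \<le> n"
  shows "qpoch c q n / qpoch q q n *
      (qpoch (q powi (- int n)) q k / qpoch (inverse c * q powi (1 - int n)) q k * (q * inverse c) ^ k) =
    qpoch c q (n - k) / qpoch q q (n - k)"
  using \<open>k \<le> n\<close>
proof (induction k)
  case (Suc k)
  define j where "j = n - Suc k"
  have n: "n = j + Suc k" and nk: "n - k = Suc j"
    using Suc.prems by (auto simp: j_def)
  have nz: "qpoch c q i \<noteq> 0" "qpoch q q i \<noteq> 0" for i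
    using qpoch_neq_0[OF c(1) q(1)] qpoch_neq_0[OF q(1) q(1)] by auto
  have f: "1 - c * q ^ j \<noteq> 0" "1 - q ^ Suc j \<noteq> 0"
    using nz(1)[of "Suc j"] nz(2)[of "Suc j"] by (auto simp: qpoch_Suc)
  have "q powi (- int n) = inverse (q ^ n)"
    by (simp add: power_int_minus)
  also have "q ^ n = q ^ Suc j * q ^ k"
    by (simp add: n power_add)
  finally have u: "q powi (- int n) * q ^ k = 1 / q ^ Suc j"
    using q by (simp add: field_simps)
  have "q powi (1 - int n) = q * q powi (- int n)"
    using q by (simp add: power_int_diff power_int_minus field_simps)
  hence "inverse c * q powi (1 - int n) * q ^ k = inverse c * q * (q powi (- int n) * q ^ k)"
    by simp
  also have "\<dots> = 1 / (c * q ^ j)"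
    unfolding u using q c by (simp add: field_simps)
  finally have v: "inverse c * q powi (1 - int n) * q ^ k = 1 / (c * q ^ j)" .
  have "(1 - 1 / q ^ Suc j) * (q * inverse c) / (1 - 1 / (c * q ^ j)) = (1 - q ^ Suc j) / (1 - c * q ^ j)"
    using f q c by (simp add: divide_simps) (simp add: algebra_simps)
  hence ratio: "(1 - 1 / q ^ Suc j) / (1 - 1 / (c * q ^ j)) * (q * inverse c) = (1 - q ^ Suc j) / (1 - c * q ^ j)"
    by simp
  have "qpoch c q n / qpoch q q n * (qpoch (q powi (- int n)) q (Suc k) /
        qpoch (inverse c * q powi (1 - int n)) q (Suc k) * (q * inverse c) ^ Suc k) =
      qpoch c q n / qpoch q q n * (qpoch (q powi (- int n)) q k /
        qpoch (inverse c * q powi (1 - int n)) q k * (q * inverse c) ^ k) *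
      ((1 - 1 / q ^ Suc j) / (1 - 1 / (c * q ^ j)) * (q * inverse c))"
    unfolding qpoch_Suc u v by (simp add: mult_ac)
  also have "\<dots> = qpoch c q (Suc j) / qpoch q q (Suc j) * ((1 - q ^ Suc j) / (1 - c * q ^ j))"
    using Suc.IH Suc.prems unfolding nk ratio by (simp add: nk)
  also have "\<dots> = qpoch c q j / qpoch q q j"
    using nz f by (simp add: qpoch_Suc)
  finally show ?case by (simp only: j_def)
qed (simp)

lemma rogers_C_eq_rogers_sum:
  assumes q: "norm q < 1" "q \<noteq> 0" and c: "norm c < 1" "c \<noteq> 0" and \<theta>: "0 \<le> \<theta>" "\<theta> \<le> pi"
  shows "rogers_C n (cos \<theta>) c q = cis \<theta> ^ n * rogers_sum c q (cis (- 2 * \<theta>)) n"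
proof -
  define w where "w = cis (- 2 * \<theta>)"
  have arccos: "arccos (cos \<theta>) = \<theta>"
    using \<theta> by (rule arccos_cos)
  have vanish: "qpoch (q powi (- int n)) q k = 0" if "k \<notin> {..n}" for k
  proof -
    have "1 - q powi (- int n) * q ^ n = 0" using q by (simp add: power_int_minus)
    thus ?thesis using that by (force simp: qpoch_def)
  qed
  have "basic_hyp [q powi (- int n), c] [inverse c * q powi (1 - int n)] q (q * inverse c * w) =
      (\<Sum>k\<le>n. qpoch (q powi (- int n)) q k * qpoch c q k /
        (qpoch q q k * qpoch (inverse c * q powi (1 - int n)) q k) * (q * inverse c * w) ^ k)"
    unfolding basic_hyp_def
    by (subst suminf_finite[of "{..n}"]) (simp_all add: vanish qpochs_def)
  hence "rogers_C n (cos \<theta>) c q = cis (real n * \<theta>) * (qpoch c q n / qpoch q q n *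
      (\<Sum>k\<le>n. qpoch (q powi (- int n)) q k * qpoch c q k /
        (qpoch q q k * qpoch (inverse c * q powi (1 - int n)) q k) * (q * inverse c * w) ^ k))"
    unfolding rogers_C_def arccos Let_def w_def[symmetric] by simp
  also have "qpoch c q n / qpoch q q n *
      (\<Sum>k\<le>n. qpoch (q powi (- int n)) q k * qpoch c q k /
        (qpoch q q k * qpoch (inverse c * q powi (1 - int n)) q k) * (q * inverse c * w) ^ k) =
      rogers_sum c q w n"
    unfolding rogers_sum_def sum_distrib_left
  proof (intro sum.cong refl)
    fix k assume "k \<in> {..n}"
    hence "k \<le> n" by simp
    have "qpoch c q n / qpoch q q n * (qpoch (q powi (- int n)) q k * qpoch c q k /
        (qpoch q q k * qpoch (inverse c * q powi (1 - int n)) q k) * (q * inverse c * w) ^ k) =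
      qpoch c q n / qpoch q q n * (qpoch (q powi (- int n)) q k /
        qpoch (inverse c * q powi (1 - int n)) q k * (q * inverse c) ^ k) *
      (qpoch c q k / qpoch q q k * w ^ k)"
      by (simp add: power_mult_distrib mult_ac)
    also have "\<dots> = qpoch c q k / qpoch q q k * (qpoch c q (n - k) / qpoch q q (n - k)) * w ^ k"
      unfolding qpoch_reverse[OF q c \<open>k \<le> n\<close>] by (simp add: mult_ac)
    finally show "qpoch c q n / qpoch q q n * (qpoch (q powi (- int n)) q k * qpoch c q k /
        (qpoch q q k * qpoch (inverse c * q powi (1 - int n)) q k) * (q * inverse c * w) ^ k) =
      qpoch c q k / qpoch q q k * (qpoch c q (n - k) / qpoch q q (n - k)) * w ^ k" .
  qed
  also have "cis (real n * \<theta>) = cis \<theta> ^ n" by (simp add: Complex.DeMoivre)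
  finally show ?thesis by (simp add: w_def)
qed

section \<open>Generating function\<close>

lemma qpoch_tendsto:
  assumes "norm q < 1"
  shows "qpoch a q \<longlonglongrightarrow> qpoch_inf a q"
    and "norm a < 1 \<Longrightarrow> qpoch_inf a q \<noteq> 0"
proof -
  have "summable (\<lambda>j. norm a * norm q ^ j)"
    using assms by (intro summable_mult summable_geometric) auto
  hence "abs_convergent_prod (\<lambda>j. 1 - a * q ^ j)"
    by (simp add: abs_convergent_prod_conv_summable norm_mult norm_power)
  hence conv: "convergent_prod (\<lambda>j. 1 - a * q ^ j)"
    by (rule abs_convergent_prod_imp_convergent_prod)
  from convergent_prod_LIMSEQ[OF this]
  have "(\<lambda>n. qpoch a q (Suc n)) \<longlonglongrightarrow> qpoch_inf a q"
    by (simp add: qpoch_def qpoch_inf_def lessThan_Suc_atMost)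
  thus "qpoch a q \<longlonglongrightarrow> qpoch_inf a q"
    by (rule LIMSEQ_imp_Suc)
  assume "norm a < 1"
  hence "1 - a * q ^ j \<noteq> 0" for j
    using qpoch_neq_0[of a q "Suc j"] assms by (auto simp: qpoch_Suc)
  thus "qpoch_inf a q \<noteq> 0"
    unfolding qpoch_inf_def by (intro prodinf_nonzero conv)
qed

text \<open>
  A convergent sequence is bounded; below also the reciprocals, since the limit is not 0.
  Every comparison with a geometric series below rests on these two bounds.
\<close>
lemma qpoch_bounded:
  assumes "norm q < 1"
  obtains K where "K > 0" "\<And>n. norm (qpoch a q n) \<le> K"
proof -
  have "Bseq (qpoch a q)"
    using qpoch_tendsto(1)[OF assms] by (intro convergent_imp_Bseq convergentI)
  thus ?thesis using that by (auto elim: BseqE)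
qed

lemma inverse_qpoch_bounded:
  assumes "norm q < 1" "norm a < 1"
  obtains K where "K > 0" "\<And>n. norm (inverse (qpoch a q n)) \<le> K"
proof -
  have "(\<lambda>n. inverse (qpoch a q n)) \<longlonglongrightarrow> inverse (qpoch_inf a q)"
    using qpoch_tendsto[OF assms(1)] assms(2) by (intro tendsto_inverse) auto
  hence "Bseq (\<lambda>n. inverse (qpoch a q n))"
    by (intro convergent_imp_Bseq convergentI)
  thus ?thesis using that by (auto elim: BseqE)
qed

lemma summable_norm_bounded_mult_power:
  fixes z :: complex
  assumes "\<And>n. norm (a n) \<le> K" "norm z < 1"
  shows "summable (\<lambda>n. norm (a n * z ^ n))"
proof (rule summable_comparison_test')
  show "summable (\<lambda>n. K * norm z ^ n)"
    using assms(2) by (intro summable_mult summable_geometric) auto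
  show "norm (norm (a n * z ^ n)) \<le> K * norm z ^ n" for n
    using assms(1)[of n] by (simp add: norm_mult norm_power mult_right_mono)
qed

text \<open>
  Euler's expansion. The sum \<open>f z\<close> satisfies \<open>(1 - z) * f z = f (z * q)\<close>; iterating this gives
  \<open>qpoch z q N * f z = f (z * q ^ N)\<close>, which tends to \<open>f 0 = 1\<close>.
\<close>
lemma q_exponential_sums:
  assumes q: "norm q < 1" and z: "norm z < 1"
  shows "summable (\<lambda>n. norm (z ^ n / qpoch q q n))"
    and "(\<lambda>n. z ^ n / qpoch q q n) sums (1 / qpoch_inf z q)"
proof -
  obtain K where K: "norm (inverse (qpoch q q n)) \<le> K" for n
    using inverse_qpoch_bounded[OF q q] by blast
  define f where "f x = (\<Sum>n. inverse (qpoch q q n) * x ^ n)" for x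
  have summ_norm: "summable (\<lambda>n. norm (inverse (qpoch q q n) * x ^ n))" if "norm x < 1" for x
    by (rule summable_norm_bounded_mult_power[OF K that])
  have summ: "summable (\<lambda>n. inverse (qpoch q q n) * x ^ n)" if "norm x < 1" for x
    by (rule summable_norm_cancel[OF summ_norm[OF that]])
  show "summable (\<lambda>n. norm (z ^ n / qpoch q q n))"
    using summ_norm[OF z] by (simp add: field_simps)
  have fun_eq: "(1 - x) * f x = f (x * q)" if x: "norm x < 1" for x
  proof -
    have xq: "norm (x * q) < 1"
      using x q mult_left_mono[of "norm q" 1 "norm x"] by (simp add: norm_mult)
    have "f x - f (x * q) = (\<Sum>n. inverse (qpoch q q n) * x ^ n - inverse (qpoch q q n) * (x * q) ^ n)"
      unfolding f_def by (rule suminf_diff[OF summ[OF x] summ[OF xq]])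
    also have "\<dots> = (\<Sum>n. inverse (qpoch q q (Suc n)) * x ^ Suc n - inverse (qpoch q q (Suc n)) * (x * q) ^ Suc n)"
      using suminf_split_head[OF summable_diff[OF summ[OF x] summ[OF xq]]] by simp
    also have "\<dots> = (\<Sum>n. x * (inverse (qpoch q q n) * x ^ n))"
    proof (rule suminf_cong)
      fix n
      have "inverse (qpoch q q (Suc n)) * (1 - q ^ Suc n) = inverse (qpoch q q n)"
        using power_neq_1[OF q, of n] by (simp add: qpoch_Suc)
      hence "x * (inverse (qpoch q q n) * x ^ n) = inverse (qpoch q q (Suc n)) * (1 - q ^ Suc n) * x ^ Suc n"
        by simp
      thus "inverse (qpoch q q (Suc n)) * x ^ Suc n - inverse (qpoch q q (Suc n)) * (x * q) ^ Suc n =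
          x * (inverse (qpoch q q n) * x ^ n)"
        by (simp add: algebra_simps power_mult_distrib)
    qed
    also have "\<dots> = x * f x"
      unfolding f_def by (rule suminf_mult[OF summ[OF x]])
    finally show ?thesis by (simp add: algebra_simps)
  qed
  have iter: "qpoch z q N * f z = f (z * q ^ N)" for N
  proof (induction N)
    case (Suc N)
    have "norm q ^ N \<le> 1" using q by (simp add: power_le_one)
    hence "norm (z * q ^ N) \<le> norm z * 1"
      unfolding norm_mult norm_power by (intro mult_left_mono) auto
    hence "norm (z * q ^ N) < 1" using z by simp
    have "qpoch z q (Suc N) * f z = (1 - z * q ^ N) * (qpoch z q N * f z)"
      by (simp add: qpoch_Suc)
    also have "\<dots> = f (z * q ^ Suc N)"
      unfolding Suc.IH fun_eq[OF \<open>norm (z * q ^ N) < 1\<close>] by (simp add: mult_ac)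
    finally show ?case .
  qed simp
  have "isCont f 0"
    unfolding f_def
    by (rule isCont_powser'[where K = "1 / 2"]) (auto intro: summ simp: norm_divide)
  moreover have "(\<lambda>N. z * q ^ N) \<longlonglongrightarrow> z * 0"
    using q by (intro tendsto_mult tendsto_const LIMSEQ_power_zero)
  ultimately have "(\<lambda>N. f (z * q ^ N)) \<longlonglongrightarrow> f 0"
    by (intro isCont_tendsto_compose[of 0 f]) auto
  moreover have "f 0 = 1"
    unfolding f_def by (subst powser_zero) simp
  moreover have "(\<lambda>N. qpoch z q N * f z) \<longlonglongrightarrow> qpoch_inf z q * f z"
    by (intro tendsto_mult tendsto_const qpoch_tendsto q)
  ultimately have "qpoch_inf z q * f z = 1"
    unfolding iter using LIMSEQ_unique by metis
  hence "f z = 1 / qpoch_inf z q"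
    by (metis nonzero_eq_divide_eq mult_zero_left mult.commute zero_neq_one)
  with summable_sums[OF summ[OF z]] show "(\<lambda>n. z ^ n / qpoch q q n) sums (1 / qpoch_inf z q)"
    unfolding f_def by (simp add: field_simps)
qed

text \<open>
  The Cauchy product of the \<open>2\<phi>1\<close> series with Euler's expansion; its coefficients are known from
  the expansion of \<open>rogers_sum\<close> in the products \<open>\<Prod>j<k. w - b * q ^ j\<close>.
\<close>
lemma rogers_generating_function:
  assumes q: "norm q < 1" and b: "norm b < 1" and t: "norm t < 1"
  shows "(\<lambda>n. t ^ n * cis \<theta> ^ n * rogers_sum b q (cis (- 2 * \<theta>)) n / qpoch (b ^ 2) q n) sums
    (1 / qpoch_inf (t * cis \<theta>) q
      * basic_hyp [b, b * cis (2 * \<theta>)] [b ^ 2] q (t * cis (- \<theta>)))"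
proof -
  define u where "u = cis \<theta>"
  have u: "u \<noteq> 0" "norm u = 1" by (simp_all add: u_def)
  have u': "cis (- \<theta>) = inverse u" "cis (2 * \<theta>) = u ^ 2" "cis (- 2 * \<theta>) = inverse (u ^ 2)"
    using cis_mult[of \<theta> \<theta>] cis_inverse[of "\<theta> + \<theta>"]
    by (simp_all add: u_def power2_eq_square cis_inverse)
  have b2: "norm (b ^ 2) < 1"
    using b by (simp add: norm_power power_less_one_iff)
  define A where "A k = qpoch b q k * qpoch (b * u ^ 2) q k / (qpoch q q k * qpoch (b ^ 2) q k)
    * (t * inverse u) ^ k" for k
  define B where "B k = (t * u) ^ k / qpoch q q k" for k
  have B: "summable (\<lambda>k. norm (B k))" "(\<Sum>k. B k) = 1 / qpoch_inf (t * u) q"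
    using q_exponential_sums[OF q, of "t * u"] t u
    unfolding B_def by (auto simp: norm_mult sums_iff)
  obtain K1 where K1: "K1 > 0" "norm (qpoch b q n) \<le> K1" for n using qpoch_bounded[OF q] by blast
  obtain K2 where K2: "K2 > 0" "norm (qpoch (b * u ^ 2) q n) \<le> K2" for n using qpoch_bounded[OF q] by blast
  obtain K3 where K3: "K3 > 0" "norm (inverse (qpoch q q n)) \<le> K3" for n
    using inverse_qpoch_bounded[OF q q] by blast
  obtain K4 where K4: "K4 > 0" "norm (inverse (qpoch (b ^ 2) q n)) \<le> K4" for n
    using inverse_qpoch_bounded[OF q b2] by blast
  have A: "summable (\<lambda>k. norm (A k))"
    unfolding A_def
  proof (rule summable_norm_bounded_mult_power)
    fix k
    have "norm (qpoch b q k * qpoch (b * u ^ 2) q k / (qpoch q q k * qpoch (b ^ 2) q k)) =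
        norm (qpoch b q k) * norm (qpoch (b * u ^ 2) q k) *
          (norm (inverse (qpoch q q k)) * norm (inverse (qpoch (b ^ 2) q k)))"
      by (simp add: norm_mult norm_divide norm_inverse field_simps)
    also have "\<dots> \<le> K1 * K2 * (K3 * K4)"
      using K1 K2 K3 K4 by (intro mult_mono) (auto intro: less_imp_le)
    finally show "norm (qpoch b q k * qpoch (b * u ^ 2) q k / (qpoch q q k * qpoch (b ^ 2) q k))
      \<le> K1 * K2 * (K3 * K4)" .
  qed (use t u in \<open>simp add: norm_mult norm_inverse\<close>)
  have A_sum: "(\<Sum>k. A k) = basic_hyp [b, b * u ^ 2] [b ^ 2] q (t * inverse u)"
    by (simp add: basic_hyp_def A_def qpochs_def)
  have coeff: "(\<Sum>k\<le>n. A k * B (n - k)) =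
      t ^ n * u ^ n * rogers_sum b q (inverse (u ^ 2)) n / qpoch (b ^ 2) q n" for n
  proof -
    have "t ^ n * u ^ n * (rogers_sum b q (inverse (u ^ 2)) n / qpoch (b ^ 2) q n) =
        (\<Sum>k\<le>n. t ^ n * u ^ n * (qpoch b q k * (\<Prod>j<k. inverse (u ^ 2) - b * q ^ j) /
          (qpoch q q k * qpoch (b ^ 2) q k * qpoch q q (n - k))))"
      unfolding rogers_sum_expansion[OF q b] sum_distrib_left ..
    also have "\<dots> = (\<Sum>k\<le>n. A k * B (n - k))"
    proof (intro sum.cong refl)
      fix k assume "k \<in> {..n}"
      hence k: "n = k + (n - k)" by simp
      have "(\<Prod>j<k. inverse (u ^ 2) - b * q ^ j) = (\<Prod>j<k. inverse (u ^ 2) * (1 - b * u ^ 2 * q ^ j))"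
        using u by (intro prod.cong refl) (simp add: field_simps)
      also have "\<dots> = inverse (u ^ 2) ^ k * qpoch (b * u ^ 2) q k"
        by (simp add: prod.distrib qpoch_def)
      finally have 1: "(\<Prod>j<k. inverse (u ^ 2) - b * q ^ j) = inverse (u ^ 2) ^ k * qpoch (b * u ^ 2) q k" .
      have "t ^ n = t ^ k * t ^ (n - k)" "u ^ n = u ^ k * u ^ (n - k)"
        by (subst k, simp only: power_add)+
      moreover have "u ^ k * inverse (u ^ 2) ^ k = inverse u ^ k"
        using u by (simp add: power_mult_distrib[symmetric] power2_eq_square mult.assoc[symmetric])
      ultimately show "t ^ n * u ^ n * (qpoch b q k * (\<Prod>j<k. inverse (u ^ 2) - b * q ^ j) /
          (qpoch q q k * qpoch (b ^ 2) q k * qpoch q q (n - k))) = A k * B (n - k)"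
        unfolding 1 A_def B_def power_mult_distrib by (simp add: mult_ac) 
    qed
    finally show ?thesis by simp
  qed
  have "(\<lambda>n. \<Sum>k\<le>n. A k * B (n - k)) sums ((\<Sum>k. A k) * (\<Sum>k. B k))"
    by (rule Cauchy_product_sums[OF A B(1)])
  thus ?thesis
    unfolding coeff A_sum B(2) u' u_def[symmetric] by (simp only: mult.commute)
qed

section \<open>Rearrangement of the double series\<close>

text \<open>
  The sets \<open>step_two_pairs n\<close> partition the index plane, as do the rows with fixed \<open>m\<close>. The
  bound by a product makes the double series absolutely convergent, so both orders of summation
  give the same value.
\<close>
lemma sums_rows_of_sums_step_two_pairs:
  fixes g :: "nat \<times> nat \<Rightarrow> complex"
  assumes bound: "\<And>m k. norm (g (m, k)) \<le> a m * s k"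
    and a: "summable a" "\<And>m. 0 \<le> a m" and s: "summable s" "\<And>k. 0 \<le> s k"
    and sums: "(\<lambda>n. \<Sum>x\<in>step_two_pairs n. g x) sums S"
  shows "(\<lambda>m. \<Sum>k. g (m, k)) sums S"
proof -
  have s_on: "(s has_sum suminf s) UNIV"
    using s by (intro norm_summable_imp_has_sum summable_sums) auto
  have "a summable_on UNIV"
    using a by (intro norm_summable_imp_summable_on) auto
  hence "(\<lambda>(m, k). a m * s k) summable_on UNIV \<times> UNIV"
    using a(2) s(2) s_on
    by (intro summable_on_SigmaI[where g = "\<lambda>m. a m * suminf s"] summable_on_cmult_left)
      (auto intro: has_sum_cmult_right)
  hence "(\<lambda>x. norm (g x)) summable_on UNIV \<times> UNIV"
    by (rule Infinite_Sum.abs_summable_on_comparison_test') (auto simp: bound)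
  hence "g summable_on UNIV"
    by (simp add: abs_summable_summable)
  then obtain S' where S': "(g has_sum S') UNIV"
    by (auto simp: summable_on_def)
  have bij: "bij_betw snd (SIGMA n:UNIV. step_two_pairs n) UNIV"
    by (rule bij_betw_byWitness[where f' = "\<lambda>(m, k). (m + 2 * k, (m, k))"])
      (auto simp: step_two_pairs_def)
  have "((\<lambda>x. g (snd x)) has_sum S') (SIGMA n:UNIV. step_two_pairs n)"
    using S' by (simp only: has_sum_reindex_bij_betw[OF bij])
  hence "((\<lambda>n. \<Sum>x\<in>step_two_pairs n. g x) has_sum S') UNIV"
    by (rule has_sum_SigmaD) (auto intro: has_sum_finite)
  hence "(\<lambda>n. \<Sum>x\<in>step_two_pairs n. g x) sums S'"
    by (rule has_sum_imp_sums)
  with sums have "S' = S" by (rule sums_unique2[symmetric])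
  have row: "((\<lambda>k. g (m, k)) has_sum (\<Sum>k. g (m, k))) UNIV" for m
  proof -
    have "summable (\<lambda>k. norm (g (m, k)))"
      by (rule summable_comparison_test'[OF summable_mult[OF s(1), of "a m"]]) (simp add: bound)
    thus ?thesis
      by (intro norm_summable_imp_has_sum summable_sums) (auto intro: summable_norm_cancel)
  qed
  have "((\<lambda>m. \<Sum>k. g (m, k)) has_sum S') UNIV"
    by (rule has_sum_SigmaD[where f = g and A = UNIV and B = "\<lambda>_. UNIV"]) (use S' row in auto)
  thus ?thesis
    unfolding \<open>S' = S\<close> by (rule has_sum_imp_sums)
qed

text \<open>
  The factors of \<open>qpoch (b\<^sup>2) q\<close> beyond the first \<open>m\<close> split by the parity of their index,
  and because of \<open>q = p\<^sup>2\<close> each is a difference of two squares. This is the source of the four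
  lower parameters with square roots of \<open>q\<close>.
\<close>
lemma qpoch_square_even_split:
  assumes "p ^ 2 = q"
  shows "qpoch (b ^ 2) q (m + 2 * k) = qpoch (b ^ 2) q m *
    (qpoch (b * p ^ m) q k * qpoch (- (b * p ^ m)) q k *
     qpoch (b * p ^ (m + 1)) q k * qpoch (- (b * p ^ (m + 1))) q k)"
proof (induction k)
  case (Suc k)
  have even: "b ^ 2 * q ^ (j + 2 * k) = (b * p ^ j * q ^ k) ^ 2" for j
    unfolding assms[symmetric] power_add power_mult_distrib
    by (simp add: mult_ac flip: power_mult)
  have factor: "1 - b ^ 2 * q ^ (j + 2 * k) = (1 - b * p ^ j * q ^ k) * (1 - - (b * p ^ j) * q ^ k)" for j
    unfolding even by algebra
  note 1 = factor[of m] and 2 = factor[of "m + 1"]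
  have "qpoch (b ^ 2) q (m + 2 * Suc k) =
      qpoch (b ^ 2) q (m + 2 * k) * (1 - b ^ 2 * q ^ (m + 2 * k)) * (1 - b ^ 2 * q ^ (m + 1 + 2 * k))"
    by (simp add: qpoch_Suc)
  thus ?case
    unfolding Suc.IH 1 2 by (simp add: qpoch_Suc mult_ac)
qed simp

text \<open>
  Linear growth in the degree, for \<open>w\<close> on the unit circle: a geometric factor then suffices
  for convergence.
\<close>
lemma rogers_sum_bound:
  assumes q: "norm q < 1" and w: "norm w = 1"
  obtains K where "K > 0" "\<And>n. norm (rogers_sum c q w n) \<le> K * real (Suc n)"
proof -
  obtain K1 where K1: "K1 > 0" "norm (qpoch c q n) \<le> K1" for n using qpoch_bounded[OF q] by blast
  obtain K2 where K2: "K2 > 0" "norm (inverse (qpoch q q n)) \<le> K2" for n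
    using inverse_qpoch_bounded[OF q q] by blast
  have h: "norm (qpoch c q n / qpoch q q n) \<le> K1 * K2" for n
    using K1 K2 unfolding divide_inverse norm_mult by (intro mult_mono) (auto intro: less_imp_le)
  have "norm (rogers_sum c q w n) \<le> K1 * K2 * (K1 * K2) * real (Suc n)" for n
  proof -
    have "norm (rogers_sum c q w n) \<le> (\<Sum>k\<le>n. K1 * K2 * (K1 * K2))"
      unfolding rogers_sum_def
    proof (rule sum_norm_le)
      fix k
      have "norm (qpoch c q k / qpoch q q k) * norm (qpoch c q (n - k) / qpoch q q (n - k)) \<le> K1 * K2 * (K1 * K2)"
        using K1 K2 by (intro mult_mono h) (auto intro: less_imp_le)
      thus "norm (qpoch c q k / qpoch q q k * (qpoch c q (n - k) / qpoch q q (n - k)) * w ^ k)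
          \<le> K1 * K2 * (K1 * K2)"
        by (simp only: norm_mult norm_power w power_one mult_1_right)
    qed
    thus ?thesis by (simp add: mult_ac)
  qed
  with K1 K2 that[of "K1 * K2 * (K1 * K2)"] show ?thesis by simp
qed

lemma connection_coeff_bound:
  assumes q: "norm q < 1" and c: "norm c < 1"
  obtains K where "K > 0" "\<And>m k. norm ((1 - c * q ^ m) * connection_coeff b c q m k) \<le> K"
proof -
  obtain K1 where K1: "K1 > 0" "norm (qpoch (b / c) q n) \<le> K1" for n using qpoch_bounded[OF q] by blast
  obtain K2 where K2: "K2 > 0" "norm (qpoch b q n) \<le> K2" for n using qpoch_bounded[OF q] by blast
  obtain K3 where K3: "K3 > 0" "norm (inverse (qpoch q q n)) \<le> K3" for n
    using inverse_qpoch_bounded[OF q q] by blast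
  obtain K4 where K4: "K4 > 0" "norm (inverse (qpoch c q n)) \<le> K4" for n
    using inverse_qpoch_bounded[OF q c] by blast
  have "norm ((1 - c * q ^ m) * connection_coeff b c q m k) \<le> 2 * (1 * K1 * K2 * (K3 * K4))" for m k
  proof -
    have "norm (c * q ^ m) \<le> 1 * 1"
      unfolding norm_mult norm_power using q c by (intro mult_mono power_le_one) auto
    hence "norm (1 - c * q ^ m) \<le> 2"
      using norm_triangle_ineq4[of 1 "c * q ^ m"] by simp
    moreover have "connection_coeff b c q m k = c ^ k * qpoch (b / c) q k * qpoch b q (m + k) *
        (inverse (qpoch q q k) * inverse (qpoch c q (Suc (m + k))))"
      by (simp add: connection_coeff_def field_simps)
    hence "norm (connection_coeff b c q m k) \<le> 1 * K1 * K2 * (K3 * K4)"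
      using c K1 K2 K3 K4
      by (simp only: norm_mult norm_power, intro mult_mono power_le_one) (auto intro: less_imp_le)
    ultimately show ?thesis
      unfolding norm_mult by (intro mult_mono) auto
  qed
  with K1 K2 K3 K4 that[of "2 * (1 * K1 * K2 * (K3 * K4))"] show ?thesis by simp
qed

text \<open>
  Splitting every shifted factorial of length \<open>m + k\<close> or \<open>m + 2 * k\<close> at \<open>m\<close> turns the
  coefficient into a factor that depends on \<open>m\<close> only and the \<open>k\<close>-th term of the \<open>6\<phi>5\<close> series.
\<close>
lemma connection_term_factor:
  assumes q: "norm q < 1" and c: "norm c < 1" and p: "p ^ 2 = q"
  shows "t ^ (m + 2 * k) / qpoch (b ^ 2) q (m + 2 * k) * ((1 - c * q ^ m) * connection_coeff b c q m k) =
    qpoch b q m * t ^ m / qpochs [c, b ^ 2] q m *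
      (qpochs [b / c, b * q ^ m, 0, 0, 0, 0] q k /
       qpochs (q # [c * q ^ (m + 1), b * p ^ m, - (b * p ^ m), b * p ^ (m + 1), - (b * p ^ (m + 1))]) q k
       * (c * t ^ 2) ^ k)"
proof -
  have nz: "qpoch c q n \<noteq> 0" for n using qpoch_neq_0[OF c q] .
  hence nz': "1 - c * q ^ m \<noteq> 0" using nz[of "Suc m"] by (auto simp: qpoch_Suc)
  have 0: "qpoch 0 q k = 1" by (simp add: qpoch_def)
  have 1: "qpoch c q (Suc (m + k)) = qpoch c q m * (1 - c * q ^ m) * qpoch (c * q ^ (m + 1)) q k"
    using qpoch_add[of c q "Suc m" k] by (simp add: qpoch_Suc)
  have 2: "t ^ (m + 2 * k) * c ^ k = t ^ m * (c * t ^ 2) ^ k"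
    by (simp add: power_add power_mult power_mult_distrib)
  have "t ^ (m + 2 * k) / qpoch (b ^ 2) q (m + 2 * k) * ((1 - c * q ^ m) * connection_coeff b c q m k) =
      (t ^ (m + 2 * k) * c ^ k) * (1 - c * q ^ m) * qpoch (b / c) q k * qpoch b q (m + k) /
        (qpoch (b ^ 2) q (m + 2 * k) * (qpoch q q k * qpoch c q (Suc (m + k))))"
    unfolding connection_coeff_def by (simp add: mult_ac)
  also have "\<dots> = qpoch b q m * t ^ m / qpochs [c, b ^ 2] q m *
      (qpochs [b / c, b * q ^ m, 0, 0, 0, 0] q k /
       qpochs (q # [c * q ^ (m + 1), b * p ^ m, - (b * p ^ m), b * p ^ (m + 1), - (b * p ^ (m + 1))]) q k
       * (c * t ^ 2) ^ k)"
    unfolding 1 2 qpoch_square_even_split[OF p] qpoch_add[of b q m k] using nz'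
    by (simp add: qpochs_def 0 mult_ac)
  finally show ?thesis .
qed

theorem theorem5:
  fixes q p t :: complex and x \<theta> \<beta> \<gamma> :: real
  assumes "0 < norm q" and "norm q < 1"
    and "p ^ 2 = q"
    and "0 \<le> \<theta>" and "\<theta> \<le> pi" and "x = cos \<theta>"
    and "\<beta> \<in> {-1<..<1} - {0}" and "\<gamma> \<in> {-1<..<1} - {0}"
    and "norm t < 1 - \<beta> ^ 2"
  defines "b \<equiv> complex_of_real \<beta>" and "c \<equiv> complex_of_real \<gamma>"
  shows "(\<lambda>n. qpoch b q n * t ^ n / qpochs [c, b ^ 2] q n * rogers_C n x c q
            * basic_hyp [b / c, b * q ^ n, 0, 0, 0, 0]
                [c * q ^ (n + 1), b * p ^ n, - (b * p ^ n), b * p ^ (n + 1), - (b * p ^ (n + 1))]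
                q (c * t ^ 2))
         sums
         (1 / qpoch_inf (t * cis \<theta>) q
            * basic_hyp [b, b * cis (2 * \<theta>)] [b ^ 2] q (t * cis (- \<theta>)))"
proof -
  have q: "norm q < 1" "q \<noteq> 0" using assms(1,2) by auto
  have b: "norm b < 1" and c: "norm c < 1" "c \<noteq> 0"
    using assms(7,8) by (auto simp: b_def c_def)
  have b2: "norm (b ^ 2) < 1"
    using b by (simp add: norm_power power_less_one_iff)
  have t: "norm t < 1" using assms(9) zero_le_power2[of \<beta>] by linarith
  define u w where "u = cis \<theta>" and "w = cis (- 2 * \<theta>)"
  have uw: "norm u = 1" "norm w = 1" by (simp_all add: u_def w_def)
  have "u ^ 2 * w = 1"
    by (simp add: u_def w_def power2_eq_square cis_mult)
  hence uw_pow: "u ^ (m + 2 * k) * w ^ k = u ^ m" for m k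
    by (simp add: power_add power_mult mult.assoc flip: power_mult_distrib)
  define H where "H = rogers_sum c q w"
  define e where "e m k = (1 - c * q ^ m) * connection_coeff b c q m k" for m k
  define g where "g = (\<lambda>(m, k). t ^ (m + 2 * k) / qpoch (b ^ 2) q (m + 2 * k) * e m k * (u ^ m * H m))"
  \<comment> \<open>Summed over \<open>m + 2 * k = n\<close> the double series is the generating function, by the connection formula.\<close>
  have diagonal: "(\<Sum>x\<in>step_two_pairs n. g x) = t ^ n * u ^ n * rogers_sum b q w n / qpoch (b ^ 2) q n" for n
    unfolding rogers_sum_connection[OF q(1) c, of b w n] sum_distrib_left sum_divide_distrib
  proof (intro sum.cong refl, clarify)
    fix m k assume "(m, k) \<in> step_two_pairs n"
    hence n: "n = m + 2 * k" by (simp add: step_two_pairs_def)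
    show "g (m, k) = t ^ n * u ^ n * ((1 - c * q ^ m) * connection_coeff b c q m k * w ^ k *
        rogers_sum c q w m) / qpoch (b ^ 2) q n"
      unfolding g_def n by (simp add: uw_pow[of m k, symmetric] e_def H_def mult_ac)
  qed
  obtain K1 where K1: "K1 > 0" "norm (H n) \<le> K1 * real (Suc n)" for n
    using rogers_sum_bound[OF q(1) uw(2)] unfolding H_def by blast
  obtain K2 where K2: "K2 > 0" "norm (e m k) \<le> K2" for m k
    using connection_coeff_bound[OF q(1) c(1)] unfolding e_def by blast
  obtain K3 where K3: "K3 > 0" "norm (inverse (qpoch (b ^ 2) q n)) \<le> K3" for n
    using inverse_qpoch_bounded[OF q(1) b2] by blast
  have bound: "norm (g (m, k)) \<le> K1 * K2 * K3 * (real (Suc m) * norm t ^ m) * (norm t ^ 2) ^ k" for m k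
  proof -
    have "norm (g (m, k)) = norm t ^ (m + 2 * k) *
        (norm (inverse (qpoch (b ^ 2) q (m + 2 * k))) * norm (e m k) * norm (H m))"
      by (simp add: g_def norm_mult norm_divide norm_power norm_inverse uw divide_inverse mult_ac)
    also have "\<dots> \<le> norm t ^ (m + 2 * k) * (K3 * K2 * (K1 * real (Suc m)))"
      using K1 K2 K3 by (intro mult_left_mono mult_mono) (auto intro: less_imp_le)
    also have "norm t ^ (m + 2 * k) = norm t ^ m * (norm t ^ 2) ^ k"
      by (simp only: power_add power_mult)
    finally show ?thesis by (simp only: mult_ac)
  qed
  \<comment> \<open>Summed over \<open>k\<close> it is the right-hand side: each row is a multiple of a \<open>6\<phi>5\<close> series.\<close>
  have row: "(\<Sum>k. g (m, k)) = qpoch b q m * t ^ m / qpochs [c, b ^ 2] q m * rogers_C m x c q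
            * basic_hyp [b / c, b * q ^ m, 0, 0, 0, 0]
                [c * q ^ (m + 1), b * p ^ m, - (b * p ^ m), b * p ^ (m + 1), - (b * p ^ (m + 1))]
                q (c * t ^ 2)" for m
  proof -
    define lower where "lower = [c * q ^ (m + 1), b * p ^ m, - (b * p ^ m), b * p ^ (m + 1), - (b * p ^ (m + 1))]"
    define \<tau> where "\<tau> k = qpochs [b / c, b * q ^ m, 0, 0, 0, 0] q k / qpochs (q # lower) q k * (c * t ^ 2) ^ k" for k
    define F where "F = qpoch b q m * t ^ m / qpochs [c, b ^ 2] q m * (u ^ m * H m)"
    have g_eq: "g (m, k) = F * \<tau> k" for k
      unfolding g_def prod.case e_def connection_term_factor[OF q(1) c(1) assms(3)]
      by (simp only: F_def \<tau>_def lower_def mult_ac)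
    have basic_hyp: "(\<Sum>k. \<tau> k) = basic_hyp [b / c, b * q ^ m, 0, 0, 0, 0] lower q (c * t ^ 2)"
      by (simp add: basic_hyp_def \<tau>_def lower_def)
    have "rogers_C m x c q = u ^ m * H m"
      unfolding assms(6) H_def u_def w_def by (rule rogers_C_eq_rogers_sum[OF q c assms(4,5)])
    hence F: "F = qpoch b q m * t ^ m / qpochs [c, b ^ 2] q m * rogers_C m x c q"
      by (simp add: F_def)
    have "(\<Sum>k. F * \<tau> k) = F * (\<Sum>k. \<tau> k)"
    proof (cases "F = 0")
      case False
      have "summable (\<lambda>k. g (m, k))"
      proof (rule summable_comparison_test'[OF _ bound])
        show "summable (\<lambda>k. K1 * K2 * K3 * (real (Suc m) * norm t ^ m) * (norm t ^ 2) ^ k)"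
          using t by (intro summable_mult summable_geometric) (simp add: power_less_one_iff)
      qed
      thus ?thesis using False unfolding g_eq by (intro suminf_mult) (simp add: summable_cmult_iff)
    qed simp
    thus ?thesis unfolding g_eq basic_hyp F lower_def .
  qed
  have "(\<lambda>m. \<Sum>k. g (m, k)) sums (1 / qpoch_inf (t * cis \<theta>) q
            * basic_hyp [b, b * cis (2 * \<theta>)] [b ^ 2] q (t * cis (- \<theta>)))"
  proof (rule sums_rows_of_sums_step_two_pairs[where a = "\<lambda>m. K1 * K2 * K3 * (real (Suc m) * norm t ^ m)"
          and s = "\<lambda>k. (norm t ^ 2) ^ k", OF bound])
    show "summable (\<lambda>m. K1 * K2 * K3 * (real (Suc m) * norm t ^ m))"
      using t geometric_deriv_sums[of "norm t"]
      by (intro summable_mult) (auto simp: sums_iff)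
    show "summable (\<lambda>k. (norm t ^ 2) ^ k)"
      using t by (intro summable_geometric) (simp add: power_less_one_iff)
    show "(\<lambda>n. \<Sum>x\<in>step_two_pairs n. g x) sums (1 / qpoch_inf (t * cis \<theta>) q
            * basic_hyp [b, b * cis (2 * \<theta>)] [b ^ 2] q (t * cis (- \<theta>)))"
      unfolding diagonal u_def w_def by (rule rogers_generating_function[OF q(1) b t])
  qed (use K1 K2 K3 in auto)
  thus ?thesis by (simp only: row)
qed

end
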